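(* Let $S$ be an LA-semigroup. If $Sa=S$ holds for all $a\in S$, or if $aS=S$ holds for all $a\in S$, then $S$ is intra-regular.
   Context: An LA-semigroup (left almost semigroup) is a nonempty set $S$ with a binary operation, written as juxtaposition, satisfying the left invertive law $(ab)c=(cb)a$ for all $a,b,c\in S$ (associativity and commutativity are not assumed). For $a\in S$, $Sa=\{sa: s\in S\}$ and $aS=\{as: s\in S\}$. $S$ is intra-regular if for every $a\in S$ there exist $x,y\in S$ such that $a=(xa^{2})y$, where $a^2=aa$. *)

theory Defs
  imports Main
begin

locale LA_semigroup =
  fixes S :: "'a set" and mult :: "'a \<Rightarrow> 'a \<Rightarrow> 'a" (infixl "\<cdot>" 70)
  assumes nonempty: "S \<noteq> {}"
    and closed: "\<lbrakk>a \<in> S; b \<in> S\<rbrakk> \<Longrightarrow> a \<cdot> b \<in> S"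
    and left_invertive: "\<lbrakk>a \<in> S; b \<in> S; c \<in> S\<rbrakk> \<Longrightarrow> (a \<cdot> b) \<cdot> c = (c \<cdot> b) \<cdot> a"

definition intra_regular :: "'a set \<Rightarrow> ('a \<Rightarrow> 'a \<Rightarrow> 'a) \<Rightarrow> bool" where
  "intra_regular S mult \<longleftrightarrow>
    (\<forall>a\<in>S. \<exists>x\<in>S. \<exists>y\<in>S. a = mult (mult x (mult a a)) y)"

end

theory Submission
  imports Defs
begin

text \<open>To solve \<open>a = (x a\<^sup>2) y\<close>, one unknown can be chosen arbitrarily. If all right translations are
  onto, fix \<open>y\<close>, write \<open>a = u y\<close>, and then write \<open>u = x a\<^sup>2\<close>. If all left translations are onto,
  fix \<open>x\<close> and solve \<open>a = (x a\<^sup>2) y\<close> for \<open>y\<close> directly.\<close>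

theorem theorem2:
  fixes S :: "'a set" and mult :: "'a \<Rightarrow> 'a \<Rightarrow> 'a" (infixl "\<cdot>" 70)
  assumes "LA_semigroup S mult"
    and "(\<forall>a\<in>S. {s \<cdot> a |s. s \<in> S} = S) \<or> (\<forall>a\<in>S. {a \<cdot> s |s. s \<in> S} = S)"
  shows "intra_regular S mult"
  unfolding intra_regular_def
proof
  interpret LA_semigroup S mult by fact
  fix a assume a: "a \<in> S"
  then have aa: "a \<cdot> a \<in> S" by (simp add: closed)
  from assms(2) show "\<exists>x\<in>S. \<exists>y\<in>S. a = x \<cdot> (a \<cdot> a) \<cdot> y"
  proof
    assume "\<forall>a\<in>S. {s \<cdot> a |s. s \<in> S} = S"
    then have divide: "\<exists>s\<in>S. c = s \<cdot> b" if "b \<in> S" "c \<in> S" for b c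
      using that by blast
    obtain u where u: "u \<in> S" "a = u \<cdot> a" using divide a by blast
    obtain x where "x \<in> S" "u = x \<cdot> (a \<cdot> a)" using divide aa u(1) by blast
    with u a show ?thesis by blast
  next
    assume "\<forall>a\<in>S. {a \<cdot> s |s. s \<in> S} = S"
    then have divide: "\<exists>s\<in>S. c = b \<cdot> s" if "b \<in> S" "c \<in> S" for b c
      using that by blast
    have "a \<cdot> (a \<cdot> a) \<in> S" using a aa by (rule closed)
    then obtain y where "y \<in> S" "a = a \<cdot> (a \<cdot> a) \<cdot> y" using divide a by blast
    with a show ?thesis by blast
  qed
qed

end
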